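(* As $n\to\infty$, $$k_0(n,3,2)=2m_0(n,3,2)\le 2.699\,\lg n\,(1+o(1)).$$
   Context: $\lg$ denotes $\log_2$. The weight of a word of length $t$ over the alphabet $\{1,\dots,d\}$ is the sum of its $t$ entries, so weights range over the integers $w$ with $t\le w\le dt$. A $k\times n$ array with entries from $\{1,\dots,d\}$ is a covering array for weight-equivalent words of length $t$ over $[d]=\{1,\dots,d\}$ if for each choice of $t$ columns a word of each weight between $t$ and $dt$ appears at least once across the rows of the selected columns. (For $d=2$ one may equivalently use the alphabet $\{0,1\}$, with weights $0,1,\dots,t$.) $k_0(n,t,d)$ denotes the minimum number $k$ of rows for which such a $k\times n$ array exists, and $m_0(n,t,d)$ denotes half of this number, $m_0(n,t,d)=k_0(n,t,d)/2$. The term $o(1)$ denotes a quantity tending to $0$ as $n\to\infty$. *)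

theory Defs
  imports Complex_Main "HOL-Library.Landau_Symbols"
begin

(* A k x n array is a function of a row index r < k and a column index c < n;
   its values outside this range are irrelevant. *)
definition is_array :: "nat \<Rightarrow> nat \<Rightarrow> nat \<Rightarrow> (nat \<Rightarrow> nat \<Rightarrow> nat) \<Rightarrow> bool" where
  "is_array k n d A \<longleftrightarrow> (\<forall>r<k. \<forall>c<n. A r c \<in> {1..d})"

(* Since the weight of a word does not depend on the order of its entries, a choice of
   t columns is a t-element set of column indices. For n < t the covering condition
   is vacuous. *)
definition weight_covering_array ::
    "nat \<Rightarrow> nat \<Rightarrow> nat \<Rightarrow> nat \<Rightarrow> (nat \<Rightarrow> nat \<Rightarrow> nat) \<Rightarrow> bool" where
  "weight_covering_array k n t d A \<longleftrightarrow>
     is_array k n d A \<and>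
     (\<forall>C. C \<subseteq> {..<n} \<and> card C = t \<longrightarrow>
        (\<forall>w\<in>{t..d * t}. \<exists>r<k. (\<Sum>c\<in>C. A r c) = w))"

definition k0 :: "nat \<Rightarrow> nat \<Rightarrow> nat \<Rightarrow> nat" where
  "k0 n t d = (LEAST k. \<exists>A. weight_covering_array k n t d A)"

definition m0 :: "nat \<Rightarrow> nat \<Rightarrow> nat \<Rightarrow> real" where
  "m0 n t d = real (k0 n t d) / 2"

end

theory Submission imports Defs begin

text \<open>
  Shift the alphabet to \<open>{0,1}\<close>. Closing a set of rows under complementation pairs weight \<open>w\<close> with
  weight \<open>3 - w\<close> on every triple of columns. So \<open>m\<close> complementary pairs of rows form a covering
  array as soon as every triple of columns has, among \<open>m\<close> representatives, a row constant on it
  (weights 0 and 3) and a row not constant on it (weights 1 and 2); this is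
  \<open>weight_covering_array_complement\<close>. The second demand holds once the columns are pairwise
  distinct, and a single row that is constant throughout meets the first for all triples at once.
  Hence \<open>m = \<lceil>lg n\<rceil> + 1\<close> pairs suffice: the columns are the binary expansions of \<open>0, \<dots>, n - 1\<close>,
  with one extra leading digit that is always 0. This gives \<open>k0 n 3 2 \<le> 2 \<lceil>lg n\<rceil> + 2\<close>, whose
  leading constant 2 is smaller than 2.699, so that the error term in the theorem can be taken
  to be 0.
\<close>

lemma weight_covering_array_complement:
  fixes B :: "nat \<Rightarrow> nat \<Rightarrow> bool"
  assumes const_row: "\<And>C. C \<subseteq> {..<n} \<Longrightarrow> card C = 3 \<Longrightarrow> \<exists>r<m. \<exists>b. \<forall>c\<in>C. B r c = b"
    and nonconst_row: "\<And>C. C \<subseteq> {..<n} \<Longrightarrow> card C = 3 \<Longrightarrow> \<exists>r<m. \<exists>c\<in>C. \<exists>c'\<in>C. B r c \<noteq> B r c'"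
  shows "weight_covering_array (2 * m) n 3 2
    (\<lambda>r c. if r < m then 1 + of_bool (B r c) else 2 - of_bool (B (r - m) c))"
    (is "weight_covering_array _ _ _ _ ?A")
  unfolding weight_covering_array_def
proof (intro conjI allI impI ballI)
  show "is_array (2 * m) n 2 ?A"
    by (auto simp: is_array_def)
next
  fix C w assume C: "C \<subseteq> {..<n} \<and> card C = 3" and w: "w \<in> {3..2 * 3::nat}"
  obtain x y z where xyz: "C = {x, y, z}" "x \<noteq> y" "x \<noteq> z" "y \<noteq> z"
    using C by (auto simp: card_3_iff)
  have weight: "(\<Sum>c\<in>{x, y, z}. f c) = f x + f y + f z" for f :: "nat \<Rightarrow> nat"
    using xyz by simp
  obtain r b where r: "r < m" "\<forall>c\<in>C. B r c = b"
    using const_row[of C] C by blast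
  obtain s c c' where s: "s < m" "c \<in> C" "c' \<in> C" "B s c \<noteq> B s c'"
    using nonconst_row[of C] C by blast
  show "\<exists>q<2 * m. (\<Sum>c\<in>C. ?A q c) = w"
  proof (cases "w = 3 \<or> w = 6")
    case True
    then have "(\<Sum>c\<in>C. ?A r c) = w \<or> (\<Sum>c\<in>C. ?A (m + r) c) = w"
      using r unfolding xyz(1) weight by (cases b) auto
    moreover have "r < 2 * m" "m + r < 2 * m"
      using r(1) by auto
    ultimately show ?thesis
      by blast
  next
    case False
    with w have "w = 4 \<or> w = 5"
      by auto
    then have "(\<Sum>c\<in>C. ?A s c) = w \<or> (\<Sum>c\<in>C. ?A (m + s) c) = w"
      using s unfolding xyz(1) weight
      by (cases "B s x"; cases "B s y"; cases "B s z") auto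
    moreover have "s < 2 * m" "m + s < 2 * m"
      using s(1) by auto
    ultimately show ?thesis
      by blast
  qed
qed

lemma ex_bit_neq_of_less_power:
  fixes a b :: nat
  assumes "a < 2 ^ l" "b < 2 ^ l" "a \<noteq> b"
  shows "\<exists>i<l. bit a i \<noteq> bit b i"
proof -
  obtain i where i: "bit a i \<noteq> bit b i"
    using assms(3) by (auto simp: bit_eq_iff)
  moreover have "bit a i \<Longrightarrow> i < l" "bit b i \<Longrightarrow> i < l"
    using assms bit_take_bit_iff[of l a i] bit_take_bit_iff[of l b i]
    by (simp_all add: take_bit_nat_eq_self)
  ultimately show ?thesis
    by blast
qed

lemma k0_3_2_le:
  assumes "n \<le> 2 ^ l"
  shows "k0 n 3 2 \<le> 2 * (l + 1)"
proof -
  have less: "c < 2 ^ l" if "c \<in> C" "C \<subseteq> {..<n}" for c C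
    using that assms by fastforce
  have "\<exists>r<l + 1. \<exists>b. \<forall>c\<in>C. bit c r = b" if "C \<subseteq> {..<n}" for C
  proof -
    \<comment> \<open>Row \<open>l\<close> is the leading digit that vanishes in every column.\<close>
    have "\<forall>c\<in>C. bit c l = False"
      using less[OF _ that] by (auto simp: bit_iff_odd)
    then show ?thesis
      by (intro exI[of _ l]) auto
  qed
  moreover have "\<exists>r<l + 1. \<exists>c\<in>C. \<exists>c'\<in>C. bit c r \<noteq> bit c' r"
    if C: "C \<subseteq> {..<n}" "card C = 3" for C
  proof -
    obtain c c' where "c \<in> C" "c' \<in> C" "c \<noteq> c'"
      using C(2) by (auto simp: card_3_iff)
    moreover from this obtain r where "r < l" "bit c r \<noteq> bit c' r"
      using ex_bit_neq_of_less_power[of c l c'] less[OF _ C(1)] by blast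
    ultimately show ?thesis
      by (intro exI[of _ r]) auto
  qed
  ultimately have "\<exists>A. weight_covering_array (2 * (l + 1)) n 3 2 A"
    using weight_covering_array_complement[of n "l + 1" "\<lambda>r c. bit c r"] by blast
  then show ?thesis
    unfolding k0_def by (rule Least_le)
qed

lemma k0_3_2_le_log:
  assumes "n \<ge> 1"
  shows "real (k0 n 3 2) \<le> 2 * log 2 (real n) + 4"
proof -
  define l where "l = nat \<lceil>log 2 (real n)\<rceil>"
  have "log 2 (real n) \<ge> 0"
    using assms by simp
  then have l: "log 2 (real n) \<le> real l" "real l \<le> log 2 (real n) + 1"
    unfolding l_def by linarith+
  have "real n \<le> 2 powr real l"
    using l(1) assms by (simp add: log_le_iff)
  then have "n \<le> 2 ^ l"
    by (simp add: powr_realpow)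
  then have "real (k0 n 3 2) \<le> real (2 * (l + 1))"
    by (intro of_nat_mono k0_3_2_le)
  also have "\<dots> \<le> 2 * log 2 (real n) + 4"
    using l(2) by simp
  finally show ?thesis .
qed

theorem theorem3p3:
  shows "(\<forall>n. real (k0 n 3 2) = 2 * m0 n 3 2) \<and>
    (\<exists>e :: nat \<Rightarrow> real. e \<in> o(\<lambda>_. 1) \<and>
      (\<forall>\<^sub>F n in at_top. 2 * m0 n 3 2 \<le> 2.699 * log 2 (real n) * (1 + e n)))"
proof (intro conjI exI[of _ "\<lambda>_. 0"])
  show "\<forall>n. real (k0 n 3 2) = 2 * m0 n 3 2"
    by (simp add: m0_def)
  show "(\<lambda>_. 0 :: real) \<in> o(\<lambda>_::nat. 1 :: real)"
    by simp
  \<comment> \<open>The additive constant 4 is absorbed as soon as \<open>0.699 * log 2 n \<ge> 4\<close>, which holds from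
    \<open>log 2 n = 6\<close> on.\<close>
  show "\<forall>\<^sub>F n in at_top. 2 * m0 n 3 2 \<le> 2.699 * log 2 (real n) * (1 + 0)"
    using eventually_ge_at_top[of 64]
  proof eventually_elim
    case (elim n)
    then have "log 2 (real n) \<ge> 6"
      by (simp add: le_log_iff)
    then show ?case
      using k0_3_2_le_log[of n] elim by (simp add: m0_def)
  qed
qed

end
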